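(* Suppose the affine control system $\dot{\boldsymbol{x}}(t)=\boldsymbol{R}(\boldsymbol{x}(t))+\boldsymbol{\mathcal{B}}(\boldsymbol{x}(t))\boldsymbol{u}(t)$ with output $\boldsymbol{y}(t)=\boldsymbol{\mathcal{C}}\boldsymbol{x}(t)$ satisfies the linearizing assumption with constant projectors $\boldsymbol{\mathcal{P}},\boldsymbol{\mathcal{Q}}$ and constant state matrix $\boldsymbol{\mathcal{A}}$. If the output controllability matrix $$\boldsymbol{\mathcal{K}}_{\boldsymbol{\mathcal{C}}}=\left(\boldsymbol{\mathcal{C}}\boldsymbol{\mathcal{P}}\,|\,\boldsymbol{\mathcal{C}}\boldsymbol{\mathcal{Q}}\boldsymbol{\mathcal{A}}\boldsymbol{\mathcal{P}}\,|\,\cdots\,|\,\boldsymbol{\mathcal{C}}(\boldsymbol{\mathcal{Q}}\boldsymbol{\mathcal{A}}\boldsymbol{\mathcal{Q}})^{n-1}\boldsymbol{\mathcal{Q}}\boldsymbol{\mathcal{A}}\boldsymbol{\mathcal{P}}\right)$$ (the blocks being $\boldsymbol{\mathcal{C}}\boldsymbol{\mathcal{P}}$ followed by $\boldsymbol{\mathcal{C}}(\boldsymbol{\mathcal{Q}}\boldsymbol{\mathcal{A}}\boldsymbol{\mathcal{Q}})^{k}\boldsymbol{\mathcal{Q}}\boldsymbol{\mathcal{A}}\boldsymbol{\mathcal{P}}$ for $k=0,\dots,n-1$) satisfies the rank condition $\operatorname{rank}(\boldsymbol{\mathcal{K}}_{\boldsymbol{\mathcal{C}}})=m$, then the system is output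 controllable.
   Context: Let $1\le p\le n$, $m\le n$, $\boldsymbol{x}(t)\in\mathbb{R}^n$ (state), $\boldsymbol{u}(t)\in\mathbb{R}^p$ (control signal), $\boldsymbol{y}(t)\in\mathbb{R}^m$ (output), $\boldsymbol{R}:\mathbb{R}^n\to\mathbb{R}^n$, and let $\boldsymbol{\mathcal{B}}(\boldsymbol{x})$ be a real $n\times p$ matrix depending on $\boldsymbol{x}\in\mathbb{R}^n$ with $\operatorname{rank}\boldsymbol{\mathcal{B}}(\boldsymbol{x})=p$ for all $\boldsymbol{x}$. Define $\boldsymbol{\mathcal{B}}^{+}(\boldsymbol{x})=\left(\boldsymbol{\mathcal{B}}^T(\boldsymbol{x})\boldsymbol{\mathcal{B}}(\boldsymbol{x})\right)^{-1}\boldsymbol{\mathcal{B}}^T(\boldsymbol{x})$ and the $n\times n$ projectors $\boldsymbol{\mathcal{P}}(\boldsymbol{x})=\boldsymbol{\mathcal{B}}(\boldsymbol{x})\boldsymbol{\mathcal{B}}^{+}(\boldsymbol{x})$, $\boldsymbol{\mathcal{Q}}(\boldsymbol{x})=\boldsymbol{1}-\boldsymbol{\mathcal{P}}(\boldsymbol{x})$. Linearizing assumption: (i) the projectors are independent of the state, $\boldsymbol{\mathcal{P}}(\boldsymbol{x})=\boldsymbol{\mathcal{P}}$ and $\boldsymbol{\mathcal{Q}}(\boldsymbol{x})=\boldsymbol{\mathcal{Q}}=\boldsymbol{1}-\boldsymbol{\mathcal{P}}$ for all $\boldsymbol{x}$; (ii) there are an $n\times n$ matrix $\boldsymbol{\mathcal{A}}$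 and a vector $\boldsymbol{b}\in\mathbb{R}^n$, both independent of the state, with $\boldsymbol{\mathcal{Q}}\boldsymbol{R}(\boldsymbol{x})=\boldsymbol{\mathcal{Q}}\boldsymbol{\mathcal{A}}\boldsymbol{x}+\boldsymbol{\mathcal{Q}}\boldsymbol{b}$ for all $\boldsymbol{x}$; (iii) the output relation is linear, $\boldsymbol{y}(t)=\boldsymbol{\mathcal{C}}\boldsymbol{x}(t)$ with a constant $m\times n$ matrix $\boldsymbol{\mathcal{C}}$ of rank $m$. Output controllable: for initial and terminal times $t_0<t_1$, any initial state $\boldsymbol{x}_0\in\mathbb{R}^n$ and any output value $\boldsymbol{y}_1\in\mathbb{R}^m$, there exist a control signal $\boldsymbol{u}:[t_0,t_1]\to\mathbb{R}^p$ and a corresponding solution $\boldsymbol{x}$ of the controlled state equation with $\boldsymbol{x}(t_0)=\boldsymbol{x}_0$ and $\boldsymbol{y}(t_1)=\boldsymbol{\mathcal{C}}\boldsymbol{x}(t_1)=\boldsymbol{y}_1$. *)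

theory Defs
  imports "HOL-Analysis.Analysis"
begin

definition pinv :: "real^'p^'n \<Rightarrow> real^'n^'p" where
  "pinv B = matrix_inv (transpose B ** B) ** transpose B"

definition proj_P :: "real^'p^'n \<Rightarrow> real^'n^'n" where
  "proj_P B = B ** pinv B"

definition proj_Q :: "real^'p^'n \<Rightarrow> real^'n^'n" where
  "proj_Q B = mat 1 - proj_P B"

(* On vectors and matrices of this library, the operation * is componentwise,
   so powers with respect to the matrix product ** need their own definition. *)
primrec mat_pow :: "real^'n^'n \<Rightarrow> nat \<Rightarrow> real^'n^'n" where
  "mat_pow M 0 = mat 1"
| "mat_pow M (Suc k) = M ** mat_pow M k"

definition linearizing_assumption ::
  "(real^'n \<Rightarrow> real^'n) \<Rightarrow> (real^'n \<Rightarrow> real^'p^'n) \<Rightarrow> real^'n^'m \<Rightarrow>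
   real^'n^'n \<Rightarrow> real^'n^'n \<Rightarrow> real^'n^'n \<Rightarrow> bool" where
  "linearizing_assumption R B C P Q A \<longleftrightarrow>
     (\<forall>x. proj_P (B x) = P \<and> proj_Q (B x) = Q) \<and>
     (\<exists>b. \<forall>x. Q *v R x = (Q ** A) *v x + Q *v b) \<and>
     rank C = CARD('m)"

(* The n + 1 blocks, each with n columns, are indexed by 'n option: None is the block C P,
   and Some i is the block C (Q A Q)^k Q A P with k = to_nat_on UNIV i. By to_nat_on_finite,
   to_nat_on UNIV is a bijection from 'n onto {..<CARD('n)}, so k takes each of the values
   0, ..., n - 1 exactly once. A column is a pair (block, column within the block). *)
definition output_controllability_matrix ::
  "real^'n^'m \<Rightarrow> real^'n^'n \<Rightarrow> real^'n^'n \<Rightarrow> real^'n^'n \<Rightarrow> real^('n option \<times> 'n)^'m" where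
  "output_controllability_matrix C P Q A =
     (\<chi> i c. (case fst c of
         None \<Rightarrow> C ** P
       | Some j \<Rightarrow> C ** mat_pow (Q ** A ** Q) (to_nat_on (UNIV :: 'n set) j) ** Q ** A ** P)
       $ i $ snd c)"

(* A classical solution on the closed interval; the derivatives at the end points are
   one-sided. The values of u and x outside the interval are irrelevant. *)
definition controlled_solution ::
  "(real^'n \<Rightarrow> real^'n) \<Rightarrow> (real^'n \<Rightarrow> real^'p^'n) \<Rightarrow> real \<Rightarrow> real \<Rightarrow>
   (real \<Rightarrow> real^'p) \<Rightarrow> (real \<Rightarrow> real^'n) \<Rightarrow> bool" where
  "controlled_solution R B t0 t1 u x \<longleftrightarrow>
     (\<forall>t\<in>{t0..t1}. (x has_vector_derivative (R (x t) + B (x t) *v u t)) (at t within {t0..t1}))"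

definition output_controllable ::
  "(real^'n \<Rightarrow> real^'n) \<Rightarrow> (real^'n \<Rightarrow> real^'p^'n) \<Rightarrow> real^'n^'m \<Rightarrow> bool" where
  "output_controllable R B C \<longleftrightarrow>
     (\<forall>t0 t1. t0 < t1 \<longrightarrow> (\<forall>x0 y1. \<exists>u x.
        controlled_solution R B t0 t1 u x \<and> x t0 = x0 \<and> C *v x t1 = y1))"

end

theory Submission
  imports Defs
begin

text \<open>
  Applying \<open>Q\<close> to the state equation removes the control, because \<open>Q B(x) = 0\<close>, and
  leaves the linear constraint equation \<open>Q x' = Q A x + Q b\<close>. Conversely, every
  differentiable curve \<open>x\<close> that satisfies this equation is the state of a controlled
  solution: with \<open>u = B\<^sup>+(x) (x' - R(x))\<close> the input supplies the \<open>P\<close> part of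
  \<open>x' - R(x)\<close>, and the \<open>Q\<close> part is zero (\<open>constrained_trajectory_controlled\<close>). The
  nonlinearity is thereby gone, and the claim concerns only the output of solutions of an
  underdetermined linear equation.

  Such solutions can be written down as power series
  \<open>x(t) = (\<Sum>k. (t - t0)^k / k! c\<^sub>k)\<close>. Taking \<open>c\<^sub>k\<^sub>+\<^sub>1 = Q A c\<^sub>k + d\<^sub>k\<close> with a bounded
  sequence \<open>d\<close>, the constraint equation only prescribes \<open>Q d\<^sub>k\<close>: it has to be \<open>Q b\<close> for
  \<open>k = 0\<close> and \<open>0\<close> for all other \<open>k\<close> (\<open>constrained_trajectory_egf\<close>). The \<open>P\<close> part of
  each \<open>d\<^sub>k\<close> remains free. This yields one solution from \<open>x\<^sub>0\<close>, and it remains to show that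
  solutions of the homogeneous equation from \<open>0\<close> reach every output at time \<open>t1\<close>.

  Their outputs form a subspace \<open>W\<close> of the output space. Let \<open>w\<close> be orthogonal to \<open>W\<close> and
  put \<open>T = t1 - t0\<close>. Choosing \<open>d\<close> to be the single impulse \<open>P a\<close> at position \<open>j - 1\<close>
  gives
  \<open>(\<Sum>l. T^(j + l) / (j + l)! g\<^sub>l) = 0\<close> with \<open>g\<^sub>l = w \<bullet> C (Q A)^l P a\<close>, for every
  \<open>j \<ge> 1\<close>. Multiplied by \<open>j! / T^j\<close>, all terms with \<open>l > 0\<close> tend to \<open>0\<close> together as
  \<open>j\<close> grows, so \<open>g\<^sub>0 = 0\<close>; dropping this term and repeating the argument yields
  \<open>g\<^sub>l = 0\<close> for all \<open>l\<close> (\<open>all_coefficients_zero\<close>). As \<open>Q\<close> is idempotent,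
  \<open>(Q A)^(k + 1) P = (Q A Q)^k Q A P\<close>, so \<open>w\<close> annihilates every column of the output
  controllability matrix. By the rank condition \<open>w = 0\<close>, hence \<open>W\<close> is the whole space
  (\<open>homogeneous_outputs_arbitrary\<close>).

  The family of impulses plays the part that the controllability Gramian or the
  differentiation of \<open>exp (t M)\<close> has in the classical argument, so neither integrals nor the
  variation of constants formula are involved.
\<close>

section \<open>The projectors of a matrix of full column rank\<close>

text \<open>
  Full column rank makes the Gram matrix \<open>B\<^sup>T B\<close> injective, since
  \<open>x \<bullet> B\<^sup>T B x\<close> is the squared norm of \<open>B x\<close>; so the inverse in the definition of
  \<open>B\<^sup>+\<close> is a genuine one.
\<close>

lemma pinv_left_inverse:
  fixes B :: "real^'p^'n"
  assumes "rank B = CARD('p)"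
  shows "pinv B ** B = mat 1"
proof -
  have inj: "inj ((*v) B)"
    using assms full_rank_injective by blast
  have "x = 0" if "(transpose B ** B) *v x = 0" for x
  proof -
    have "(B *v x) \<bullet> (B *v x) = x \<bullet> ((transpose B ** B) *v x)"
      by (metis dot_lmul_matrix inner_commute matrix_vector_mul_assoc transpose_matrix_vector)
    with that have "B *v x = B *v 0" by simp
    with inj show ?thesis by (meson injD)
  qed
  then have "invertible (transpose B ** B)"
    unfolding invertible_left_inverse matrix_left_invertible_ker by blast
  then have "matrix_inv (transpose B ** B) ** (transpose B ** B) = mat 1"
    unfolding invertible_def matrix_inv_def by (rule someI2_ex) simp
  then show ?thesis
    by (simp add: pinv_def matrix_mul_assoc)
qed

lemma
  fixes B :: "real^'p^'n"
  assumes "rank B = CARD('p)"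
  shows proj_P_idem: "proj_P B ** proj_P B = proj_P B"
    and proj_Q_proj_P: "proj_Q B ** proj_P B = 0"
    and proj_Q_idem: "proj_Q B ** proj_Q B = proj_Q B"
proof -
  have "proj_P B ** proj_P B = B ** (pinv B ** B) ** pinv B"
    by (simp add: proj_P_def matrix_mul_assoc)
  then show PP: "proj_P B ** proj_P B = proj_P B"
    by (simp add: pinv_left_inverse[OF assms] proj_P_def)
  show QP: "proj_Q B ** proj_P B = 0"
    using PP by (simp add: matrix_eq proj_Q_def matrix_vector_mult_diff_rdistrib
        flip: matrix_vector_mul_assoc)
  show "proj_Q B ** proj_Q B = proj_Q B"
    using QP by (simp add: matrix_eq proj_Q_def[of B] matrix_vector_mult_diff_distrib
        matrix_vector_mult_diff_rdistrib flip: matrix_vector_mul_assoc)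
qed

section \<open>Exponential generating functions\<close>

definition egf :: "(nat \<Rightarrow> 'a::euclidean_space) \<Rightarrow> real \<Rightarrow> 'a" where
  "egf c s = (\<Sum>k. (s ^ k / fact k) *\<^sub>R c k)"

text \<open>
  Geometric growth of the coefficients is enough for an exponential generating function to
  converge everywhere. Unlike boundedness, it is inherited by the iterates of a bounded
  linear map.
\<close>

definition exp_bounded :: "(nat \<Rightarrow> 'a::real_normed_vector) \<Rightarrow> bool" where
  "exp_bounded c \<longleftrightarrow> (\<exists>D G. \<forall>k. norm (c k) \<le> D * G ^ k)"

lemma exp_bounded_Suc:
  assumes "exp_bounded c"
  shows "exp_bounded (\<lambda>k. c (Suc k))"
proof -
  obtain D G where "\<And>k. norm (c k) \<le> D * G ^ k"
    using assms exp_bounded_def by blast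
  then have "norm (c (Suc k)) \<le> (D * G) * G ^ k" for k
    by (metis mult.assoc power_Suc)
  then show ?thesis
    unfolding exp_bounded_def by blast
qed

lemma exp_bounded_bounded_linear:
  assumes "exp_bounded c" "bounded_linear f"
  shows "exp_bounded (\<lambda>k. f (c k))"
proof -
  obtain D G where *: "\<And>k. norm (c k) \<le> D * G ^ k"
    using assms exp_bounded_def by blast
  obtain K where K: "0 \<le> K" "\<And>x. norm (f x) \<le> norm x * K"
    using bounded_linear.nonneg_bounded[OF assms(2)] by blast
  have "norm (f (c k)) \<le> (D * K) * G ^ k" for k
    using K(2)[of "c k"] mult_right_mono[OF *[of k] K(1)] by (simp add: algebra_simps)
  then show ?thesis
    unfolding exp_bounded_def by blast
qed

lemma exp_bounded_power:
  assumes "exp_bounded c"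
  shows "exp_bounded (\<lambda>k. s ^ k *\<^sub>R c k)"
proof -
  obtain D G where *: "\<And>k. norm (c k) \<le> D * G ^ k"
    using assms exp_bounded_def by blast
  have "norm (s ^ k *\<^sub>R c k) \<le> D * (\<bar>s\<bar> * G) ^ k" for k
    using mult_left_mono[OF *[of k], of "\<bar>s\<bar> ^ k"]
    by (simp add: power_abs power_mult_distrib algebra_simps)
  then show ?thesis
    unfolding exp_bounded_def by blast
qed

lemma summable_egf:
  fixes c :: "nat \<Rightarrow> 'a::euclidean_space"
  assumes "exp_bounded c"
  shows "summable (\<lambda>k. (s ^ k / fact k) *\<^sub>R c k)"
proof -
  obtain D G where *: "\<And>k. norm (c k) \<le> D * G ^ k"
    using assms exp_bounded_def by blast
  have "summable (\<lambda>k. D * (inverse (fact k) * (\<bar>s\<bar> * G) ^ k))"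
    by (intro summable_mult summable_exp)
  then show ?thesis
  proof (rule summable_comparison_test'[where N = 0])
    fix k
    have "norm ((s ^ k / fact k) *\<^sub>R c k) = \<bar>s\<bar> ^ k / fact k * norm (c k)"
      by (simp add: power_abs)
    also have "\<dots> \<le> \<bar>s\<bar> ^ k / fact k * (D * G ^ k)"
      by (intro mult_left_mono *) auto
    finally show "norm ((s ^ k / fact k) *\<^sub>R c k) \<le> D * (inverse (fact k) * (\<bar>s\<bar> * G) ^ k)"
      by (simp add: power_mult_distrib field_simps)
  qed
qed

lemma egf_0: "egf c 0 = c 0"
proof -
  have "(\<lambda>k. (0 ^ k / fact k) *\<^sub>R c k) sums (\<Sum>k\<in>{0}. (0 ^ k / fact k) *\<^sub>R c k)"
    by (rule sums_finite) auto
  then show ?thesis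
    by (simp add: egf_def sums_iff)
qed

lemma egf_add:
  assumes "exp_bounded c" "exp_bounded d"
  shows "egf (\<lambda>k. c k + d k) s = egf c s + egf d s"
  unfolding egf_def by (simp add: suminf_add summable_egf assms scaleR_add_right)

lemma egf_bounded_linear:
  assumes "exp_bounded c" "bounded_linear f"
  shows "f (egf c s) = egf (\<lambda>k. f (c k)) s"
  unfolding egf_def
  by (simp add: bounded_linear.suminf[OF assms(2) summable_egf[OF assms(1)]]
      linear_simps(5)[OF assms(2)])

text \<open>
  The factorials in an exponential generating function turn differentiation into the shift of
  the coefficient sequence. Each coordinate is a scalar power series, which may be
  differentiated term by term.
\<close>

lemma egf_has_vector_derivative:
  fixes c :: "nat \<Rightarrow> 'a::euclidean_space"
  assumes "exp_bounded c"
  shows "(egf c has_vector_derivative egf (\<lambda>k. c (Suc k)) s) (at s)"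
  unfolding has_vector_derivative_def
proof (subst has_derivative_componentwise_within, intro ballI)
  fix b :: 'a
  assume "b \<in> Basis"
  define a where "a k = (c k \<bullet> b) / fact k" for k
  have inner: "egf d y \<bullet> b = (\<Sum>k. (d k \<bullet> b) / fact k * y ^ k)"
    if "exp_bounded d" for d :: "nat \<Rightarrow> 'a" and y :: real
    using egf_bounded_linear[OF that bounded_linear_inner_left[of b], of y]
    by (simp add: egf_def field_simps)
  have "summable (\<lambda>k. a k * y ^ k)" for y
    using summable_egf[OF exp_bounded_bounded_linear[OF assms bounded_linear_inner_left[of b]], of y]
    by (simp add: a_def field_simps)
  then have "((\<lambda>y. \<Sum>k. a k * y ^ k) has_field_derivative (\<Sum>k. diffs a k * s ^ k)) (at s)"
    by (rule termdiffs_strong_converges_everywhere)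
  also have "(\<Sum>k. diffs a k * s ^ k) = egf (\<lambda>k. c (Suc k)) s \<bullet> b"
    by (simp add: inner[OF exp_bounded_Suc[OF assms]] diffs_def a_def field_simps
        del: of_nat_Suc)
  also have "(\<lambda>y. \<Sum>k. a k * y ^ k) = (\<lambda>y. egf c y \<bullet> b)"
    by (simp add: inner[OF assms] a_def)
  finally show "((\<lambda>x. egf c x \<bullet> b) has_derivative
      (\<lambda>x. (x *\<^sub>R egf (\<lambda>k. c (Suc k)) s) \<bullet> b)) (at s)"
    by (simp add: has_field_derivative_def mult.commute[of _ "_ \<bullet> _"])
qed

section \<open>Series with shifted factorials\<close>

lemma summable_divide_shifted_fact:
  fixes h :: "nat \<Rightarrow> real"
  assumes "exp_bounded h"
  shows "summable (\<lambda>l. h l / fact (j + l))"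
proof -
  obtain D G where bound: "\<And>l. \<bar>h l\<bar> \<le> D * G ^ l"
    using assms by (auto simp: exp_bounded_def)
  have "summable (\<lambda>l. D * (inverse (fact l) * G ^ l))"
    by (intro summable_mult summable_exp)
  then show ?thesis
  proof (rule summable_comparison_test'[where N = 0])
    fix l
    have "norm (h l / fact (j + l)) \<le> \<bar>h l\<bar> / fact l"
      by (simp add: frac_le fact_mono)
    also have "\<dots> \<le> D * G ^ l / fact l"
      by (intro divide_right_mono bound) simp
    finally show "norm (h l / fact (j + l)) \<le> D * (inverse (fact l) * G ^ l)"
      by (simp add: field_simps)
  qed
qed

text \<open>
  After multiplication with \<open>j!\<close> the first term is \<open>h 0\<close>, whereas the sum of the others is
  at most a constant divided by \<open>j + 1\<close>: the factorial of \<open>j + 1 + l\<close> is at least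
  \<open>(j + 1)! l!\<close>, and the tail is thus dominated by an exponential series that does not
  depend on \<open>j\<close>. So \<open>h 0\<close> vanishes in the limit.
\<close>

lemma leading_coefficient_zero:
  fixes h :: "nat \<Rightarrow> real"
  assumes h: "exp_bounded h"
    and zero: "\<And>j. N \<le> j \<Longrightarrow> (\<Sum>l. h l / fact (j + l)) = 0"
  shows "h 0 = 0"
proof -
  obtain D G where bound: "\<And>l. \<bar>h l\<bar> \<le> D * G ^ l"
    using h by (auto simp: exp_bounded_def)
  define b where "b l = D * G * (inverse (fact l) * G ^ l)" for l
  have b: "summable b"
    unfolding b_def by (intro summable_mult summable_exp)
  have small: "\<bar>h 0\<bar> \<le> suminf b / real (Suc j)" if "N \<le> j" for j
  proof -
    define r where "r l = h (Suc l) / fact (j + Suc l)" for l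
    have r: "norm (r l) \<le> b l / fact (Suc j)" for l
    proof -
      have "fact (Suc j) * fact l \<le> (fact (Suc j + l) :: nat)"
        by (intro dvd_imp_le fact_fact_dvd_fact) auto
      then have "fact (Suc j) * fact l \<le> (fact (j + Suc l) :: real)"
        by (metis add_Suc_shift of_nat_fact of_nat_le_iff of_nat_mult)
      then have "norm (r l) \<le> \<bar>h (Suc l)\<bar> / (fact (Suc j) * fact l)"
        unfolding r_def by (simp add: frac_le del: fact_Suc)
      also have "\<dots> \<le> D * G ^ Suc l / (fact (Suc j) * fact l)"
        by (intro divide_right_mono bound) simp
      finally show ?thesis
        by (simp add: b_def field_simps del: fact_Suc)
    qed
    have "suminf r = - (h 0 / fact j)"
      using zero[OF that] suminf_split_head[OF summable_divide_shifted_fact[OF h, of j]]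
      by (simp add: r_def[abs_def] del: fact_Suc)
    then have "\<bar>h 0\<bar> / fact j = norm (suminf r)"
      by simp
    also have "\<dots> \<le> (\<Sum>l. b l / fact (Suc j))"
      by (rule norm_suminf_le[OF r summable_divide[OF b]])
    also have "\<dots> = suminf b / fact (Suc j)"
      by (rule suminf_divide[OF b])
    finally have "fact j * (\<bar>h 0\<bar> / fact j) \<le> fact j * (suminf b / fact (Suc j))"
      by (rule mult_left_mono) simp
    then show ?thesis
      by (simp add: divide_simps)
  qed
  have "(\<lambda>j. suminf b / real (Suc j)) \<longlonglongrightarrow> 0"
    by (rule real_tendsto_divide_at_top[OF tendsto_const
          filterlim_compose[OF filterlim_real_sequentially filterlim_Suc]])
  then have "\<bar>h 0\<bar> \<le> 0"
    by (rule LIMSEQ_le_const) (use small in blast)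
  then show ?thesis by simp
qed

text \<open>
  Once the leading coefficient is known to vanish, the remaining series are those of the
  shifted sequence with \<open>j + 1\<close> in place of \<open>j\<close>. Only large \<open>j\<close> are required in the
  hypothesis so that it survives this raising of the threshold \<open>N\<close>.
\<close>

lemma all_coefficients_zero:
  fixes h :: "nat \<Rightarrow> real"
  assumes "exp_bounded h"
    and "\<And>j. N \<le> j \<Longrightarrow> (\<Sum>l. h l / fact (j + l)) = 0"
  shows "h l = 0"
  using assms
proof (induction l arbitrary: h N)
  case 0
  then show ?case by (rule leading_coefficient_zero)
next
  case (Suc l)
  have "h 0 = 0"
    using Suc.prems by (rule leading_coefficient_zero)
  then have "(\<Sum>l. h (Suc l) / fact (Suc j + l)) = 0" if "N \<le> j" for j
    using Suc.prems(2)[OF that]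
      suminf_split_head[OF summable_divide_shifted_fact[OF Suc.prems(1), of j]]
    by (simp del: fact_Suc)
  then have "(\<Sum>l. h (Suc l) / fact (j + l)) = 0" if "Suc N \<le> j" for j
    using that by (cases j) auto
  with exp_bounded_Suc[OF Suc.prems(1)] show ?case
    by (rule Suc.IH)
qed

section \<open>Trajectories of the constraint equation\<close>

text \<open>
  As an exponential generating function, this sequence solves \<open>x' = L x + f(t)\<close>, where the
  forcing term \<open>f\<close> is the one with coefficients \<open>d\<close>.
\<close>

primrec forced_iterates :: "('a \<Rightarrow> 'a) \<Rightarrow> 'a \<Rightarrow> (nat \<Rightarrow> 'a) \<Rightarrow> nat \<Rightarrow> 'a::euclidean_space" where
  "forced_iterates L c0 d 0 = c0"
| "forced_iterates L c0 d (Suc k) = L (forced_iterates L c0 d k) + d k"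

lemma exp_bounded_forced_iterates:
  assumes "bounded_linear L" and d: "\<And>k. norm (d k) \<le> D"
  shows "exp_bounded (forced_iterates L c0 d)"
proof -
  obtain K where K: "0 \<le> K" "\<And>x. norm (L x) \<le> norm x * K"
    using bounded_linear.nonneg_bounded[OF assms(1)] by blast
  define E where "E = max D (norm c0)"
  have E: "0 \<le> E" unfolding E_def by (simp add: le_max_iff_disj)
  have "norm (forced_iterates L c0 d k) \<le> E * (K + 1) ^ k" for k
  proof (induction k)
    case 0
    then show ?case by (simp add: E_def)
  next
    case (Suc k)
    have "norm (d k) \<le> E * 1"
      using d[of k] by (simp add: E_def)
    also have "\<dots> \<le> E * (K + 1) ^ k"
      using E K(1) by (intro mult_left_mono one_le_power) auto
    finally have "norm (d k) \<le> E * (K + 1) ^ k" .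
    moreover have "norm (L (forced_iterates L c0 d k)) \<le> E * (K + 1) ^ k * K"
      using K(2)[of "forced_iterates L c0 d k"] mult_right_mono[OF Suc K(1)] by linarith
    ultimately show ?case
      using norm_triangle_ineq[of "L (forced_iterates L c0 d k)" "d k"] by (simp add: algebra_simps)
  qed
  then show ?thesis
    unfolding exp_bounded_def by blast
qed

text \<open>
  The part of the state equation on which the control has no influence. A derivative \<open>x'\<close> is
  part of the notion because the equation fixes only its image under \<open>Q\<close>.
\<close>

definition constrained_trajectory ::
  "real^'n^'n \<Rightarrow> real^'n^'n \<Rightarrow> real^'n \<Rightarrow> real \<Rightarrow> real \<Rightarrow> (real \<Rightarrow> real^'n) \<Rightarrow> bool" where
  "constrained_trajectory Q A q t0 t1 x \<longleftrightarrow>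
     (\<exists>x'. \<forall>t\<in>{t0..t1}. (x has_vector_derivative x' t) (at t within {t0..t1}) \<and>
        Q *v x' t = (Q ** A) *v x t + q)"

lemma constrained_trajectory_add:
  assumes "constrained_trajectory Q A q t0 t1 x" "constrained_trajectory Q A r t0 t1 z"
  shows "constrained_trajectory Q A (q + r) t0 t1 (\<lambda>t. x t + z t)"
proof -
  obtain x' z' where
    "\<forall>t\<in>{t0..t1}. (x has_vector_derivative x' t) (at t within {t0..t1}) \<and>
       Q *v x' t = (Q ** A) *v x t + q"
    "\<forall>t\<in>{t0..t1}. (z has_vector_derivative z' t) (at t within {t0..t1}) \<and>
       Q *v z' t = (Q ** A) *v z t + r"
    using assms unfolding constrained_trajectory_def by blast
  then show ?thesis
    unfolding constrained_trajectory_def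
    by (intro exI[of _ "\<lambda>t. x' t + z' t"])
      (auto intro!: has_vector_derivative_add simp: matrix_vector_right_distrib)
qed

lemma constrained_trajectory_scaleR:
  assumes "constrained_trajectory Q A q t0 t1 x"
  shows "constrained_trajectory Q A (r *\<^sub>R q) t0 t1 (\<lambda>t. r *\<^sub>R x t)"
proof -
  obtain x' where
    "\<forall>t\<in>{t0..t1}. (x has_vector_derivative x' t) (at t within {t0..t1}) \<and>
       Q *v x' t = (Q ** A) *v x t + q"
    using assms unfolding constrained_trajectory_def by blast
  then show ?thesis
    unfolding constrained_trajectory_def
    by (intro exI[of _ "\<lambda>t. r *\<^sub>R x' t"])
      (auto intro!: bounded_linear.has_vector_derivative[OF bounded_linear_scaleR_right]
        simp: matrix_vector_mult_scaleR scaleR_add_right)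
qed

text \<open>
  Shifting the coefficients differentiates the series, and by \<open>Q Q = Q\<close> the recurrence gives
  \<open>Q c\<^sub>k\<^sub>+\<^sub>1 = Q A c\<^sub>k + Q d\<^sub>k\<close>. The prescribed values \<open>Q d\<^sub>k\<close> are the coefficients of the
  constant function \<open>q\<close>, while the components of \<open>d\<^sub>k\<close> in the kernel of \<open>Q\<close> are
  arbitrary.
\<close>

lemma constrained_trajectory_egf:
  assumes QQ: "Q ** Q = Q" and d: "\<And>k. norm (d k) \<le> D"
    and Qd: "\<And>k. Q *v d k = (if k = 0 then q else 0)"
  shows "constrained_trajectory Q A q t0 t1
    (\<lambda>t. egf (forced_iterates ((*v) (Q ** A)) x0 d) (t - t0))"
proof -
  define c where "c = forced_iterates ((*v) (Q ** A)) x0 d"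
  have c: "exp_bounded c"
    unfolding c_def by (rule exp_bounded_forced_iterates[OF matrix_vector_mul_bounded_linear d])
  have q: "exp_bounded (\<lambda>k::nat. if k = 0 then q else 0)"
    unfolding exp_bounded_def by (intro exI[of _ "norm q"] exI[of _ 1]) auto
  have "Q *v egf (\<lambda>k. c (Suc k)) s = (Q ** A) *v egf c s + q" for s
  proof -
    have "Q *v c (Suc k) = (Q ** A) *v c k + (if k = 0 then q else 0)" for k
      by (simp add: c_def matrix_vector_right_distrib Qd matrix_vector_mul_assoc
          matrix_mul_assoc QQ)
    then have "Q *v egf (\<lambda>k. c (Suc k)) s
        = egf (\<lambda>k. (Q ** A) *v c k + (if k = 0 then q else 0)) s"
      by (simp add: egf_bounded_linear[OF exp_bounded_Suc[OF c]])
    also have "\<dots> = (Q ** A) *v egf c s + egf (\<lambda>k. if k = 0 then q else 0) s"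
      using c q by (simp add: egf_add exp_bounded_bounded_linear egf_bounded_linear)
    also have "egf (\<lambda>k. if k = 0 then q else 0) s = q"
    proof -
      have "(\<lambda>k. (s ^ k / fact k) *\<^sub>R (if k = 0 then q else 0)) sums
          (\<Sum>k\<in>{0}. (s ^ k / fact k) *\<^sub>R (if k = 0 then q else 0))"
        by (rule sums_finite) auto
      then show ?thesis by (simp add: egf_def sums_iff)
    qed
    finally show ?thesis .
  qed
  moreover have "((\<lambda>t. egf c (t - t0)) has_vector_derivative egf (\<lambda>k. c (Suc k)) (t - t0))
      (at t within S)" for t S
  proof -
    have "((\<lambda>t. t - t0) has_vector_derivative 1) (at t within S)"
      by (auto intro!: derivative_eq_intros)
    from vector_diff_chain_within[OF this, of "egf c" "egf (\<lambda>k. c (Suc k)) (t - t0)"]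
    show ?thesis
      using has_vector_derivative_at_within[OF egf_has_vector_derivative[OF c]]
      by (simp add: o_def)
  qed
  ultimately show ?thesis
    unfolding constrained_trajectory_def c_def
    by (intro exI[of _ "\<lambda>t. egf (\<lambda>k. forced_iterates ((*v) (Q ** A)) x0 d (Suc k)) (t - t0)"]) blast
qed

text \<open>
  The control \<open>B\<^sup>+(x) (x' - R(x))\<close> contributes \<open>P (x' - R(x))\<close> to the state equation. The
  constraint equation says that \<open>x' - R(x)\<close> lies in the kernel of \<open>Q = 1 - P\<close>, so this
  contribution is all of \<open>x' - R(x)\<close>.
\<close>

lemma constrained_trajectory_controlled:
  fixes B :: "real^'n \<Rightarrow> real^'p^'n"
  assumes P: "\<And>x. proj_P (B x) = P" and Q: "\<And>x. proj_Q (B x) = Q"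
    and R: "\<And>x. Q *v R x = (Q ** A) *v x + q"
    and "constrained_trajectory Q A q t0 t1 x"
  shows "\<exists>u. controlled_solution R B t0 t1 u x"
proof -
  obtain x' where x': "\<forall>t\<in>{t0..t1}. (x has_vector_derivative x' t) (at t within {t0..t1}) \<and>
      Q *v x' t = (Q ** A) *v x t + q"
    using assms(4) unfolding constrained_trajectory_def by blast
  define u where "u t = pinv (B (x t)) *v (x' t - R (x t))" for t
  have "R (x t) + B (x t) *v u t = x' t" if "t \<in> {t0..t1}" for t
  proof -
    have "B (x t) *v u t = P *v (x' t - R (x t))"
      by (simp add: u_def matrix_vector_mul_assoc P[of "x t", symmetric] proj_P_def)
    also have "P = mat 1 - Q"
      using P[of "x t"] Q[of "x t"] by (auto simp: proj_Q_def)
    also have "(mat 1 - Q) *v (x' t - R (x t)) = x' t - R (x t)"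
      using x' that by (simp add: matrix_vector_mult_diff_rdistrib matrix_vector_mult_diff_distrib R)
    finally show ?thesis by simp
  qed
  with x' have "controlled_solution R B t0 t1 u x"
    unfolding controlled_solution_def by simp
  then show ?thesis by blast
qed

section \<open>Output controllability\<close>

lemma forced_iterates_impulse:
  assumes "linear L"
  shows "forced_iterates L 0 (\<lambda>k. if k = j then a else 0)
    k = (if k \<le> j then 0 else (L ^^ (k - Suc j)) a)"
proof (induction k)
  case (Suc k)
  have "k - j = Suc (k - Suc j)" if "j < k"
    using that by simp
  with Suc show ?case
    by (auto simp: linear_0[OF assms] not_le less_Suc_eq)
qed simp

text \<open>
  This identifies the iterates of \<open>Q A\<close> on the range of \<open>P\<close> with the blocks of the output
  controllability matrix; idempotence of \<open>Q\<close> allows a factor \<open>Q\<close> to be inserted between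
  consecutive copies of \<open>Q A\<close>.
\<close>

lemma funpow_QA_P:
  "(((*v) (Q ** A)) ^^ Suc k) (P *v a) = (mat_pow (Q ** A ** Q) k ** Q ** A ** P) *v a"
  if "Q ** Q = Q" for Q A P :: "real^'n^'n"
proof (induction k)
  case 0
  then show ?case by (simp add: matrix_vector_mul_assoc matrix_mul_assoc)
next
  case (Suc k)
  have "Q ** mat_pow (Q ** A ** Q) k ** Q = mat_pow (Q ** A ** Q) k ** Q"
  proof (cases k)
    case 0
    then show ?thesis by (simp add: that)
  next
    case (Suc i)
    then show ?thesis by (simp add: that matrix_mul_assoc)
  qed
  then show ?case
    using Suc by (simp add: matrix_vector_mul_assoc matrix_mul_assoc)
       (metis matrix_mul_assoc)
qed

text \<open>
  The attainable outputs form a subspace, so it suffices that only \<open>w = 0\<close> is orthogonal to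
  all of them. The impulse responses already force this: letting the position of the impulse
  vary gives infinitely many linear relations between the numbers
  \<open>w \<bullet> C (Q A)^l P a\<close>, which together make each of them vanish.
\<close>

lemma homogeneous_outputs_arbitrary:
  fixes C :: "real^'n^'m" and P Q A :: "real^'n^'n"
  assumes QQ: "Q ** Q = Q" and QP: "Q ** P = 0" and t: "t0 < t1"
    and rank: "rank (output_controllability_matrix C P Q A) = CARD('m)"
  shows "\<exists>x. constrained_trajectory Q A 0 t0 t1 x \<and> x t0 = 0 \<and> C *v x t1 = y"
proof -
  define W where "W = {C *v x t1 |x. constrained_trajectory Q A 0 t0 t1 x \<and> x t0 = 0}"
  define L where "L = (*v) (Q ** A)"
  have L: "linear L" "bounded_linear L"
    unfolding L_def by (simp_all add: matrix_vector_mul_bounded_linear)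
  have egf_in_W: "C *v egf (forced_iterates L 0 d) (t1 - t0) \<in> W"
    if "\<And>k. norm (d k) \<le> D" "\<And>k. Q *v d k = 0" for d D
  proof -
    have "constrained_trajectory Q A 0 t0 t1 (\<lambda>t. egf (forced_iterates L 0 d) (t - t0))"
      unfolding L_def using that by (intro constrained_trajectory_egf[OF QQ]) auto
    then show ?thesis
      unfolding W_def by (force simp: egf_0)
  qed
  have "subspace W"
    unfolding subspace_def
  proof (intro conjI ballI allI)
    have "constrained_trajectory Q A 0 t0 t1 (\<lambda>t. 0)"
      unfolding constrained_trajectory_def by (intro exI[of _ "\<lambda>t. 0"]) simp
    then show "0 \<in> W"
      unfolding W_def by force
  next
    fix v w assume "v \<in> W" "w \<in> W"
    then obtain x z where "constrained_trajectory Q A 0 t0 t1 x" "x t0 = 0" "v = C *v x t1"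
      "constrained_trajectory Q A 0 t0 t1 z" "z t0 = 0" "w = C *v z t1"
      unfolding W_def by blast
    then show "v + w \<in> W"
      unfolding W_def using constrained_trajectory_add[of Q A 0 t0 t1 x 0 z]
      by (auto intro!: exI[of _ "\<lambda>t. x t + z t"] simp: matrix_vector_right_distrib)
  next
    fix r v assume "v \<in> W"
    then obtain x where "constrained_trajectory Q A 0 t0 t1 x" "x t0 = 0" "v = C *v x t1"
      unfolding W_def by blast
    then show "r *\<^sub>R v \<in> W"
      unfolding W_def using constrained_trajectory_scaleR[of Q A 0 t0 t1 x r]
      by (auto intro!: exI[of _ "\<lambda>t. r *\<^sub>R x t"] simp: matrix_vector_mult_scaleR)
  qed
  have "w = 0" if w: "\<And>v. v \<in> W \<Longrightarrow> w \<bullet> v = 0" for w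
  proof -
    have coeff: "w \<bullet> (C *v (L ^^ l) (P *v a)) = 0" for a l
    proof -
      define g where "g l = w \<bullet> (C *v (L ^^ l) (P *v a))" for l
      define h where "h l = (t1 - t0) ^ l * g l" for l
      have functional: "bounded_linear (\<lambda>v. w \<bullet> (C *v v))"
        by (rule bounded_linear_compose[OF bounded_linear_inner_right
              matrix_vector_mul_bounded_linear])
      \<comment> \<open>The response to the impulse \<open>P a\<close> at position \<open>i\<close>; its coefficients start at
        index \<open>i + 1\<close>, so the initial value is \<open>0\<close>.\<close>
      define c where "c i = forced_iterates L 0 (\<lambda>k. if k = i then P *v a else 0)" for i
      have c: "exp_bounded (c i)" for i
        unfolding c_def by (rule exp_bounded_forced_iterates[OF L(2), where D = "norm (P *v a)"]) simp
      have g: "w \<bullet> (C *v c i k) = (if k \<le> i then 0 else g (k - Suc i))" for i k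
        by (simp add: c_def forced_iterates_impulse[OF L(1)] g_def)
      \<comment> \<open>The sequence \<open>g\<close> is the response to the impulse at position \<open>0\<close>, without its
        leading zero.\<close>
      have "exp_bounded g"
        using exp_bounded_Suc[OF exp_bounded_bounded_linear[OF c[of 0] functional]]
        by (simp add: g)
      then have "exp_bounded h"
        using exp_bounded_power[of g "t1 - t0"] by (simp add: h_def[abs_def])
      moreover have "(\<Sum>l. h l / fact (j + l)) = 0" if "1 \<le> j" for j
      proof -
        define i where "i = j - 1"
        have j: "j = Suc i" using that by (simp add: i_def)
        define f where "f k = (t1 - t0) ^ k / fact k * (w \<bullet> (C *v c i k))" for k
        have "suminf f = w \<bullet> (C *v egf (c i) (t1 - t0))"
          using egf_bounded_linear[OF c functional] by (simp add: egf_def f_def[abs_def])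
        also have "\<dots> = 0"
          unfolding c_def
          by (intro w egf_in_W[where D = "norm (P *v a)"])
            (auto simp: matrix_vector_mul_assoc QP)
        finally have "suminf f = 0" .
        moreover have "summable f"
          using summable_egf[OF exp_bounded_bounded_linear[OF c functional]]
          by (simp add: f_def[abs_def])
        moreover have "(\<Sum>k<j. f k) = 0"
          by (simp add: f_def g j)
        ultimately have "(\<Sum>l. f (l + j)) = 0"
          using suminf_split_initial_segment[of f j] by simp
        also have "(\<lambda>l. f (l + j)) = (\<lambda>l. (t1 - t0) ^ j * (h l / fact (j + l)))"
          by (auto simp: f_def g h_def j power_add add.commute)
        also have "(\<Sum>l. (t1 - t0) ^ j * (h l / fact (j + l)))
            = (t1 - t0) ^ j * (\<Sum>l. h l / fact (j + l))"
          by (rule suminf_mult[OF summable_divide_shifted_fact[OF \<open>exp_bounded h\<close>]])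
        finally show ?thesis
          using t by simp
      qed
      ultimately have "h l = 0"
        by (rule all_coefficients_zero)
      then show ?thesis
        using t by (simp add: h_def g_def)
    qed
    define K where "K = output_controllability_matrix C P Q A"
    have "transpose K *v w = 0"
    proof (rule vec_eq_iff[THEN iffD2], intro allI)
      fix c :: "'n option \<times> 'n"
      obtain blk i where c: "c = (blk, i)" by fastforce
      define M where "M = (case blk of
         None \<Rightarrow> C ** P
       | Some j \<Rightarrow> C ** mat_pow (Q ** A ** Q) (to_nat_on (UNIV :: 'n set) j) ** Q ** A ** P)"
      have "w \<bullet> (M *v axis i 1) = 0"
      proof (cases blk)
        case None
        then show ?thesis
          using coeff[of 0 "axis i 1"] by (simp add: M_def matrix_vector_mul_assoc)
      next
        case (Some j)
        then show ?thesis
          using coeff[of "Suc (to_nat_on (UNIV :: 'n set) j)" "axis i 1"]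
          unfolding L_def funpow_QA_P[OF QQ]
          by (simp add: M_def matrix_vector_mul_assoc matrix_mul_assoc)
      qed
      moreover have "(transpose K *v w) $ c = w \<bullet> (M *v axis i 1)"
        by (simp add: K_def M_def output_controllability_matrix_def c matrix_vector_mult_basis
            column_def inner_vec_def vector_matrix_mult_def mult.commute)
      ultimately show "(transpose K *v w) $ c = 0 $ c" by simp
    qed
    moreover have "inj ((*v) (transpose K))"
      using rank by (simp add: K_def full_rank_injective[symmetric] rank_transpose
          del: transpose_matrix_vector)
    ultimately show "w = 0"
      by (metis injD matrix_vector_mult_0_right)
  qed
  then have "\<not> dim W < DIM(real^'m)"
    by (metis orthogonal_def orthogonal_to_subspace_exists span_base)
  then have "span W = UNIV"
    using dim_subset_UNIV[of W] dim_eq_full[of W] by linarith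
  then have "W = UNIV"
    using \<open>subspace W\<close> by (simp add: span_eq_iff[THEN iffD2])
  then have "y \<in> W" by simp
  then show ?thesis
    unfolding W_def by blast
qed

theorem theorem6:
  fixes R :: "real^'n \<Rightarrow> real^'n"
    and B :: "real^'n \<Rightarrow> real^'p^'n"
    and C :: "real^'n^'m"
    and P Q A :: "real^'n^'n"
  assumes "CARD('p) \<le> CARD('n)"
    and "CARD('m) \<le> CARD('n)"
    and "\<And>x. rank (B x) = CARD('p)"
    and "linearizing_assumption R B C P Q A"
    and "rank (output_controllability_matrix C P Q A) = CARD('m)"
  shows "output_controllable R B C"
  unfolding output_controllable_def
proof (intro allI impI)
  fix t0 t1 :: real and x0 y1
  assume t: "t0 < t1"
  obtain b where PQ: "\<And>x. proj_P (B x) = P" "\<And>x. proj_Q (B x) = Q"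
    and R: "\<And>x. Q *v R x = (Q ** A) *v x + Q *v b"
    using assms(4) unfolding linearizing_assumption_def by blast
  have QQ: "Q ** Q = Q" and QP: "Q ** P = 0"
    using proj_Q_idem[OF assms(3), of 0] proj_Q_proj_P[OF assms(3), of 0] by (simp_all add: PQ)
  \<comment> \<open>One admissible motion from \<open>x0\<close>, with no
    forcing in the range of \<open>P\<close>: it solves the linear equation \<open>x' = Q A x + Q b\<close>. The
    deviation of its final output from \<open>y1\<close> is then corrected by a homogeneous trajectory.\<close>
  define x where
    "x t = egf (forced_iterates ((*v) (Q ** A)) x0 (\<lambda>k. if k = 0 then Q *v b else 0)) (t - t0)" for t
  have x: "constrained_trajectory Q A (Q *v b) t0 t1 x"
    unfolding x_def
    by (rule constrained_trajectory_egf[OF QQ, where D = "norm (Q *v b)"])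
      (auto simp: matrix_vector_mul_assoc QQ)
  obtain z where z: "constrained_trajectory Q A 0 t0 t1 z" "z t0 = 0" "C *v z t1 = y1 - C *v x t1"
    using homogeneous_outputs_arbitrary[OF QQ QP t assms(5)] by blast
  obtain u where "controlled_solution R B t0 t1 u (\<lambda>t. x t + z t)"
    using constrained_trajectory_controlled[OF PQ R] constrained_trajectory_add[OF x z(1)]
    by fastforce
  moreover have "x t0 + z t0 = x0" "C *v (x t1 + z t1) = y1"
    by (simp_all add: x_def egf_0 z matrix_vector_right_distrib)
  ultimately show "\<exists>u x. controlled_solution R B t0 t1 u x \<and> x t0 = x0 \<and> C *v x t1 = y1"
    by blast
qed

end
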